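(* (1) There exists a strong $U$-structure. (2) There exists a structure $\mathcal A=\langle A,P,Q\rangle$ with $P,Q$ unary relations which is a strong $U$-structure with some core $U_0$ such that $P=Q=U_0$.
   Context: Fix a natural number $n$. All vocabularies consist of relation symbols only; equality is always available. $\mathcal{L}_n$ is first-order logic using only the variables $v_0,\dots,v_{n-1}$. For $\bar s\in{}^kA$, $\ker(\bar s)=\{(i,j)\in k\times k:s_i=s_j\}$; for $U_0\subseteq A$, $\bar s\sim\bar z$ iff $\ker(\bar s)=\ker(\bar z)$ and $s_i\in U_0\iff z_i\in U_0$ for all $i<k$. $A^{*m}$ is the set of $m$-tuples of $A$ with pairwise distinct entries. A $U$-structure is a relational structure $\mathcal A$ with universe $A$ together with a subset $U_0\subseteq A$ (the core, not named in the vocabulary) with $|U_0|\ge n$, $|A\setminus U_0|\ge n$, every basic relation closed under $\sim$. "Definable" means definable without parameters by an $\mathcal L_n$-formula of the relevant vocabulary. A $U$-structure is strong if for every sub-vocabulary $W$ such that $U_0$ is not definable in $\mathcal A|_W$, every $m\le n$, every $m$-ary $R\subseteq A^{*m}$ definable in $\mathcal A|_W$ and all distinct $i,j<m$: $\mathcal A\models\forall\bar v[R(\bar v)\leftrightarrow(\exists v_iR(\bar v)\wedge\exists v_jR(\bar v)\wedge A^{*m}(\bar v))]$. *)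

theory Defs
  imports Main
begin

text \<open>A relational structure carries its vocabulary as a set of symbols; \<open>arity\<close> and \<open>interp\<close>
  are irrelevant outside that set, so a reduct only shrinks \<open>vocab\<close>. Tuples are lists.\<close>

record ('r, 'a) rel_structure =
  universe :: "'a set"
  vocab :: "'r set"
  arity :: "'r \<Rightarrow> nat"
  interp :: "'r \<Rightarrow> 'a list set"

definition tuples :: "'a set \<Rightarrow> nat \<Rightarrow> 'a list set" where
  "tuples A k = {s. length s = k \<and> set s \<subseteq> A}"

definition distinct_tuples :: "'a set \<Rightarrow> nat \<Rightarrow> 'a list set" where
  "distinct_tuples A m = {s \<in> tuples A m. distinct s}"

definition is_structure :: "('r, 'a) rel_structure \<Rightarrow> bool" where
  "is_structure S \<longleftrightarrow>
     universe S \<noteq> {} \<and> (\<forall>r\<in>vocab S. interp S r \<subseteq> tuples (universe S) (arity S r))"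

definition reduct :: "('r, 'a) rel_structure \<Rightarrow> 'r set \<Rightarrow> ('r, 'a) rel_structure" where
  "reduct S W = S\<lparr>vocab := W\<rparr>"

datatype 'r fm =
    Bot
  | Eq nat nat
  | Rel 'r "nat list"
  | Neg "'r fm"
  | Conj "'r fm" "'r fm"
  | Ex nat "'r fm"

primrec vars :: "'r fm \<Rightarrow> nat set" where
  "vars Bot = {}"
| "vars (Eq i j) = {i, j}"
| "vars (Rel r is) = set is"
| "vars (Neg \<phi>) = vars \<phi>"
| "vars (Conj \<phi> \<psi>) = vars \<phi> \<union> vars \<psi>"
| "vars (Ex i \<phi>) = insert i (vars \<phi>)"

primrec free_vars :: "'r fm \<Rightarrow> nat set" where
  "free_vars Bot = {}"
| "free_vars (Eq i j) = {i, j}"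
| "free_vars (Rel r is) = set is"
| "free_vars (Neg \<phi>) = free_vars \<phi>"
| "free_vars (Conj \<phi> \<psi>) = free_vars \<phi> \<union> free_vars \<psi>"
| "free_vars (Ex i \<phi>) = free_vars \<phi> - {i}"

primrec in_vocab :: "('r, 'a) rel_structure \<Rightarrow> 'r fm \<Rightarrow> bool" where
  "in_vocab S Bot \<longleftrightarrow> True"
| "in_vocab S (Eq i j) \<longleftrightarrow> True"
| "in_vocab S (Rel r is) \<longleftrightarrow> r \<in> vocab S \<and> length is = arity S r"
| "in_vocab S (Neg \<phi>) \<longleftrightarrow> in_vocab S \<phi>"
| "in_vocab S (Conj \<phi> \<psi>) \<longleftrightarrow> in_vocab S \<phi> \<and> in_vocab S \<psi>"
| "in_vocab S (Ex i \<phi>) \<longleftrightarrow> in_vocab S \<phi>"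

text \<open>\<open>\<L>\<^sub>n\<close>: the restriction to the variables below \<open>n\<close> concerns bound variables as well.\<close>

definition Ln :: "nat \<Rightarrow> ('r, 'a) rel_structure \<Rightarrow> 'r fm set" where
  "Ln n S = {\<phi>. in_vocab S \<phi> \<and> vars \<phi> \<subseteq> {..<n}}"

primrec sat :: "('r, 'a) rel_structure \<Rightarrow> (nat \<Rightarrow> 'a) \<Rightarrow> 'r fm \<Rightarrow> bool" where
  "sat S e Bot \<longleftrightarrow> False"
| "sat S e (Eq i j) \<longleftrightarrow> e i = e j"
| "sat S e (Rel r is) \<longleftrightarrow> map e is \<in> interp S r"
| "sat S e (Neg \<phi>) \<longleftrightarrow> \<not> sat S e \<phi>"
| "sat S e (Conj \<phi> \<psi>) \<longleftrightarrow> sat S e \<phi> \<and> sat S e \<psi>"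
| "sat S e (Ex i \<phi>) \<longleftrightarrow> (\<exists>a\<in>universe S. sat S (e(i := a)) \<phi>)"

text \<open>The valuation sends \<open>v\<^sub>i\<close> to the \<open>i\<close>-th entry of the tuple; its unspecified values at
  \<open>i \<ge> k\<close> do not matter because the free variables of \<open>\<phi>\<close> lie below \<open>k\<close>.\<close>

definition definable :: "nat \<Rightarrow> ('r, 'a) rel_structure \<Rightarrow> nat \<Rightarrow> 'a list set \<Rightarrow> bool" where
  "definable n S k R \<longleftrightarrow>
     (\<exists>\<phi>\<in>Ln n S. free_vars \<phi> \<subseteq> {..<k} \<and>
        R = {s \<in> tuples (universe S) k. sat S (\<lambda>i. s ! i) \<phi>})"

definition unary :: "'a set \<Rightarrow> 'a list set" where
  "unary X = {[x] | x. x \<in> X}"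

definition ker :: "'a list \<Rightarrow> (nat \<times> nat) set" where
  "ker s = {(i, j). i < length s \<and> j < length s \<and> s ! i = s ! j}"

definition sim :: "'a set \<Rightarrow> 'a list \<Rightarrow> 'a list \<Rightarrow> bool" where
  "sim U\<^sub>0 s z \<longleftrightarrow> length s = length z \<and> ker s = ker z \<and>
     (\<forall>i<length s. s ! i \<in> U\<^sub>0 \<longleftrightarrow> z ! i \<in> U\<^sub>0)"

definition at_least :: "nat \<Rightarrow> 'a set \<Rightarrow> bool" where
  "at_least n X \<longleftrightarrow> infinite X \<or> n \<le> card X"

definition U_structure :: "nat \<Rightarrow> ('r, 'a) rel_structure \<Rightarrow> 'a set \<Rightarrow> bool" where
  "U_structure n S U\<^sub>0 \<longleftrightarrow>
     is_structure S \<and> U\<^sub>0 \<subseteq> universe S \<and>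
     at_least n U\<^sub>0 \<and> at_least n (universe S - U\<^sub>0) \<and>
     (\<forall>r\<in>vocab S. \<forall>s\<in>interp S r. \<forall>z\<in>tuples (universe S) (arity S r).
        sim U\<^sub>0 s z \<longrightarrow> z \<in> interp S r)"

definition strong_U_structure :: "nat \<Rightarrow> ('r, 'a) rel_structure \<Rightarrow> 'a set \<Rightarrow> bool" where
  "strong_U_structure n S U\<^sub>0 \<longleftrightarrow>
     U_structure n S U\<^sub>0 \<and>
     (\<forall>W\<subseteq>vocab S. \<not> definable n (reduct S W) 1 (unary U\<^sub>0) \<longrightarrow>
       (\<forall>m\<le>n. \<forall>R. R \<subseteq> distinct_tuples (universe S) m \<longrightarrow> definable n (reduct S W) m R \<longrightarrow>
         (\<forall>i<m. \<forall>j<m. i \<noteq> j \<longrightarrow>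
           (\<forall>v\<in>tuples (universe S) m.
              v \<in> R \<longleftrightarrow>
                (\<exists>a\<in>universe S. v[i := a] \<in> R) \<and>
                (\<exists>a\<in>universe S. v[j := a] \<in> R) \<and>
                v \<in> distinct_tuples (universe S) m))))"

end

theory Submission
  imports Defs
begin

text \<open>Take the even numbers as the core and let both predicates name it. A nonempty
  sub-vocabulary defines the core outright, so strength only concerns the language of pure
  equality. There every definable relation is invariant under permutations of the universe, and
  a transposition carries any distinct tuple to any other one that differs from it in a single
  entry.\<close>

text \<open>Injectivity of \<open>f\<close> settles equality atoms, relational atoms do not occur,
  and \<open>f\<close> carries quantifier witnesses onto the whole universe. The valuations are
  linked only on free variables because list indexing past the end of a tuple need not commute with
  \<open>f\<close>.\<close>

lemma sat_permutation_invariant: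
  assumes "vocab S = {}" "bij f" "f ` universe S = universe S"
  shows "in_vocab S \<phi> \<Longrightarrow> (\<And>i. i \<in> free_vars \<phi> \<Longrightarrow> e' i = f (e i)) \<Longrightarrow> sat S e' \<phi> \<longleftrightarrow> sat S e \<phi>"
proof (induction \<phi> arbitrary: e e')
  case (Eq i j)
  then show ?case using \<open>bij f\<close> by (simp add: bij_def inj_eq)
next
  case (Rel r ks)
  then show ?case using assms(1) by simp
next
  case (Conj \<phi> \<psi>)
  have "sat S e' \<phi> \<longleftrightarrow> sat S e \<phi>" "sat S e' \<psi> \<longleftrightarrow> sat S e \<psi>"
    using Conj by auto
  then show ?case by simp
next
  case (Ex i \<phi>)
  have "sat S (e'(i := f a)) \<phi> \<longleftrightarrow> sat S (e(i := a)) \<phi>" for a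
    by (rule Ex.IH) (use Ex.prems in auto)
  \<comment> \<open>A witness \<open>a\<close> on the right corresponds to \<open>f a\<close> on the
    left.\<close>
  then have "(\<exists>a\<in>f ` universe S. sat S (e'(i := a)) \<phi>) \<longleftrightarrow> (\<exists>a\<in>universe S. sat S (e(i := a)) \<phi>)"
    by blast
  then show ?case using assms(3) by simp
qed auto

lemma definable_permutation_invariant:
  assumes "definable n S k R" "vocab S = {}" "bij f" "f ` universe S = universe S" "v \<in> R"
  shows "map f v \<in> R"
proof -
  obtain \<phi> where \<phi>: "\<phi> \<in> Ln n S" "free_vars \<phi> \<subseteq> {..<k}"
    and R: "R = {s \<in> tuples (universe S) k. sat S (\<lambda>i. s ! i) \<phi>}"
    using assms(1) unfolding definable_def by blast
  have v: "v \<in> tuples (universe S) k" "sat S (\<lambda>i. v ! i) \<phi>"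
    using assms(5) R by auto
  have "sat S (\<lambda>i. map f v ! i) \<phi> \<longleftrightarrow> sat S (\<lambda>i. v ! i) \<phi>"
    by (rule sat_permutation_invariant[OF assms(2-4)])
      (use \<phi> v in \<open>auto simp: Ln_def tuples_def\<close>)
  moreover have "map f v \<in> tuples (universe S) k"
    using v(1) assms(4) by (auto simp: tuples_def)
  ultimately show ?thesis using v(2) R by simp
qed

text \<open>Swapping \<open>a\<close> and \<open>v ! i\<close> moves no entry other than the one at
  \<open>i\<close>: distinctness of \<open>v\<close> keeps \<open>v ! i\<close>, and distinctness of
  \<open>v[i := a]\<close> keeps \<open>a\<close>, away from all other positions. If
  \<open>a = v ! i\<close>, the map is the identity.\<close>

lemma map_transpose_distinct:
  assumes "distinct v" "distinct (v[i := a])" "i < length v"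
  shows "map (id(a := v ! i, v ! i := a)) (v[i := a]) = v"
proof (rule nth_equalityI)
  fix j assume "j < length (map (id(a := v ! i, v ! i := a)) (v[i := a]))"
  then have j: "j < length v" by simp
  show "map (id(a := v ! i, v ! i := a)) (v[i := a]) ! j = v ! j"
  proof (cases "j = i")
    case False
    have "v ! j \<noteq> v ! i"
      using assms j False by (simp add: nth_eq_iff_index_eq)
    moreover have "v ! j \<noteq> a"
      using nth_eq_iff_index_eq[OF assms(2), of j i] assms(3) j False by simp
    ultimately show ?thesis using j False by simp
  qed (use assms in auto)
qed simp

text \<open>Gives the right-to-left half of the equivalence in strength. The inclusion of
  \<open>R\<close> in the distinct tuples makes \<open>v[i := a]\<close> distinct, so the
  transposition of \<open>a\<close> and \<open>v ! i\<close> sends it back to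
  \<open>v\<close>.\<close>

lemma definable_change_entry:
  assumes "definable n S m R" "vocab S = {}" "R \<subseteq> distinct_tuples (universe S) m"
    and "v \<in> distinct_tuples (universe S) m" "i < m" "a \<in> universe S" "v[i := a] \<in> R"
  shows "v \<in> R"
proof -
  let ?f = "id(a := v ! i, v ! i := a)"
  have v: "distinct v" "length v = m" "v ! i \<in> universe S" "distinct (v[i := a])"
    using assms by (auto simp: distinct_tuples_def tuples_def)
  have invol: "?f (?f x) = x" for x by simp
  then have "bij ?f" by (rule involuntory_imp_bij)
  moreover have sub: "?f ` universe S \<subseteq> universe S" using v assms(6) by auto
  \<comment> \<open>As its own inverse, \<open>?f\<close> maps the universe onto itself once it maps
    it into itself.\<close>
  have "?f ` universe S = universe S"
  proof (intro equalityI sub subsetI)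
    fix x assume "x \<in> universe S"
    then have "?f x \<in> universe S" using sub by blast
    then show "x \<in> ?f ` universe S" using invol by (metis imageI)
  qed
  ultimately have "map ?f (v[i := a]) \<in> R"
    using definable_permutation_invariant[OF assms(1,2) _ _ assms(7)] by blast
  then show ?thesis using map_transpose_distinct v assms(5) by metis
qed

text \<open>The atom \<open>Rel r [0]\<close> is the defining formula; \<open>0 < n\<close> admits
  its variable.\<close>

lemma definable_named_predicate:
  assumes "is_structure S" "r \<in> vocab S" "arity S r = 1" "interp S r = unary X" "0 < n"
  shows "definable n S 1 (unary X)"
proof -
  have "unary X \<subseteq> tuples (universe S) 1"
    using assms(1-4) by (metis is_structure_def)
  then have "unary X = {s \<in> tuples (universe S) 1. sat S (\<lambda>i. s ! i) (Rel r [0])}"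
    using assms(4) by (auto simp: tuples_def length_Suc_conv)
  moreover have "Rel r [0] \<in> Ln n S" using assms by (simp add: Ln_def)
  ultimately show ?thesis unfolding definable_def by (intro bexI[of _ "Rel r [0]"]) auto
qed

lemma strong_U_structure_named_core:
  assumes S: "U_structure n S U\<^sub>0"
    and named: "\<And>r. r \<in> vocab S \<Longrightarrow> arity S r = 1 \<and> interp S r = unary U\<^sub>0"
  shows "strong_U_structure n S U\<^sub>0"
  unfolding strong_U_structure_def
proof (intro conjI allI impI ballI S)
  fix W m R i j v
  assume W: "W \<subseteq> vocab S" "\<not> definable n (reduct S W) 1 (unary U\<^sub>0)"
    and R: "m \<le> n" "R \<subseteq> distinct_tuples (universe S) m" "definable n (reduct S W) m R"
    and ij: "i < m" "j < m" "i \<noteq> j" and v: "v \<in> tuples (universe S) m"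
  have "is_structure (reduct S W)"
    using S W(1) by (auto simp: U_structure_def is_structure_def reduct_def)
  \<comment> \<open>Any symbol in \<open>W\<close> would define the core in the reduct; the required
    \<open>0 < n\<close> comes from \<open>i < m \<le> n\<close>.\<close>
  then have "W = {}"
    using W named R(1) ij(1) definable_named_predicate[of "reduct S W" _ U\<^sub>0 n]
    by (fastforce simp: reduct_def)
  then have change: "v \<in> R"
    if "v \<in> distinct_tuples (universe S) m" "a \<in> universe S" "v[i := a] \<in> R" for a
    using definable_change_entry[OF R(3), of v i a] R(2) ij(1) that by (simp add: reduct_def)
  \<comment> \<open>For the left-to-right half, the entries of \<open>v\<close> themselves are the
    witnesses.\<close>
  have same: "v ! k \<in> universe S" if "k < m" for k
    using v that by (auto simp: tuples_def)
  show "v \<in> R \<longleftrightarrow> (\<exists>a\<in>universe S. v[i := a] \<in> R) \<and> (\<exists>a\<in>universe S. v[j := a] \<in> R) \<and>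
      v \<in> distinct_tuples (universe S) m"
    using change R(2) same[OF ij(1)] same[OF ij(2)] by (metis list_update_id subsetD)
qed

lemma infinite_parity_class: "infinite {x::nat. even x}" "infinite {x::nat. odd x}"
proof -
  have "infinite (range (\<lambda>k::nat. 2 * k))" "infinite (range (\<lambda>k::nat. 2 * k + 1))"
    by (simp_all add: finite_image_iff inj_on_def)
  moreover have "range (\<lambda>k::nat. 2 * k) = {x. even x}" "range (\<lambda>k::nat. 2 * k + 1) = {x. odd x}"
    by (auto elim: oddE)
  ultimately show "infinite {x::nat. even x}" "infinite {x::nat. odd x}"
    by simp_all
qed

theorem theorem2p6:
  fixes n :: nat
  shows "(\<exists>(S :: (nat, nat) rel_structure) U\<^sub>0. strong_U_structure n S U\<^sub>0) \<and>
         (\<exists>(S :: (nat, nat) rel_structure) U\<^sub>0 P Q.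
            P \<noteq> Q \<and> vocab S = {P, Q} \<and> arity S P = 1 \<and> arity S Q = 1 \<and>
            strong_U_structure n S U\<^sub>0 \<and>
            interp S P = unary U\<^sub>0 \<and> interp S Q = unary U\<^sub>0)"
proof -
  define U :: "nat set" where "U = {x. even x}"
  \<comment> \<open>One structure serves both claims. Its core and the complement are infinite,
    hence large enough for every \<open>n\<close>; its relations are closed under
    \<open>sim U\<close> since that preserves membership in \<open>U\<close> entrywise.\<close>
  define S :: "(nat, nat) rel_structure" where
    "S = \<lparr>universe = UNIV, vocab = {0, 1}, arity = \<lambda>_. 1, interp = \<lambda>_. unary U\<rparr>"
  have "UNIV - U = {x. odd x}" by (auto simp: U_def)
  then have "U_structure n S U"
    using infinite_parity_class
    by (auto simp: U_structure_def is_structure_def S_def at_least_def U_def tuples_def unary_def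
        sim_def length_Suc_conv)
  then have "strong_U_structure n S U"
    by (rule strong_U_structure_named_core) (simp add: S_def)
  moreover have "(0::nat) \<noteq> 1 \<and> vocab S = {0, 1} \<and> arity S 0 = 1 \<and> arity S 1 = 1 \<and>
      interp S 0 = unary U \<and> interp S 1 = unary U"
    by (simp add: S_def)
  ultimately show ?thesis by blast
qed

end
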